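(* Let $d\in\{1,2,3\}$ and let $G^{\epsilon,n}$ denote the two-parameter family of regularized kernels on $\mathbb{R}^d$, with $r=\|\mathbf{x}\|$. Let $\delta$ be the Dirac delta at the origin of $\mathbb{R}^d$. Then, in the weak sense, $$ \lim_{n\to\infty}\Delta G^{\epsilon,n}(r)=-\delta(r)\quad\text{for any }\epsilon>0, $$ $$ \lim_{\epsilon\to0}\Delta G^{\epsilon,n}(r)=-\delta(r)\quad\text{for any integer } n\ge 0. $$
   Context: Here $\|\cdot\|$ is the Euclidean norm on $\mathbb{R}^d$, and $\Delta$ is the $d$-dimensional Laplacian acting on the radial function $\mathbf{x}\mapsto G^{\epsilon,n}(\|\mathbf{x}\|)$. The limit $\epsilon\to0$ is taken over $\epsilon>0$. Convergence in the weak sense to $-\delta$ means that $\int_{\mathbb{R}^d}\Delta G^{\epsilon,n}(\|\mathbf{x}\|)f(\mathbf{x})\,d\mathbf{x}\to -f(0)$ for every compactly supported smooth function $f$ on $\mathbb{R}^d$. For $\epsilon>0$ and an integer $n\ge 0$, the two-parameter family of regularized kernels is $$ G^{\epsilon,n}(r)= \begin{cases} \displaystyle -\frac12\sum_{\ell=0}^n\binom{\frac12}{\ell}(-\epsilon^2)^\ell(r^2+\epsilon^2)^{\frac12-\ell} & \text{in }\mathbb{R}^1,\\[2ex] \displaystyle -\frac{1}{4\pi}\ln(r^2+\epsilon^2)+\frac{1}{4\pi}\sum_{\ell=1}^n\frac{1}{\ell}\epsilon^{2\ell}(r^2+\epsilon^2)^{-\ell} & \text{in }\mathbb{R}^2,\\[2ex]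 \displaystyle \frac{1}{4\pi}\sum_{\ell=0}^n\binom{-\frac12}{\ell}(-\epsilon^2)^\ell(r^2+\epsilon^2)^{-\frac12-\ell} & \text{in }\mathbb{R}^3, \end{cases} $$ where $\binom{\alpha}{\ell}=\frac{1}{\ell!}\prod_{k=0}^{\ell-1}(\alpha-k)$ is the generalized binomial coefficient for $\alpha\in\mathbb{R}$. *)

theory Defs
  imports "HOL-Analysis.Analysis"
begin

definition partial_derivative ::
    "'a::euclidean_space \<Rightarrow> ('a \<Rightarrow> real) \<Rightarrow> 'a \<Rightarrow> real" where
  "partial_derivative b u x = deriv (\<lambda>t. u (x + t *\<^sub>R b)) 0"

definition laplacian :: "('a::euclidean_space \<Rightarrow> real) \<Rightarrow> 'a \<Rightarrow> real" where
  "laplacian u x = (\<Sum>b\<in>Basis. partial_derivative b (partial_derivative b u) x)"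

text \<open>\<open>C_times k f\<close>: the function \<open>f\<close> is \<open>k\<close> times continuously differentiable on the
  whole space. Since \<open>deriv\<close> is a total function, differentiability is required explicitly.\<close>

primrec C_times :: "nat \<Rightarrow> ('a::euclidean_space \<Rightarrow> real) \<Rightarrow> bool" where
  "C_times 0 f \<longleftrightarrow> continuous_on UNIV f"
| "C_times (Suc k) f \<longleftrightarrow>
     (\<forall>x. f differentiable (at x)) \<and> (\<forall>b\<in>Basis. C_times k (partial_derivative b f))"

definition test_function :: "('a::euclidean_space \<Rightarrow> real) \<Rightarrow> bool" where
  "test_function f \<longleftrightarrow> (\<forall>k. C_times k f) \<and> compact (closure {x. f x \<noteq> 0})"

text \<open>A distribution is represented by its action on test functions.\<close>

definition dirac_delta :: "('a::euclidean_space \<Rightarrow> real) \<Rightarrow> real" where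
  "dirac_delta f = f 0"

text \<open>Weak convergence of a family of functions to a distribution. The Bochner integral of a
  non-integrable function is \<open>0\<close>, so integrability is demanded as well.\<close>

definition weakly_tendsto ::
    "('i \<Rightarrow> 'a::euclidean_space \<Rightarrow> real) \<Rightarrow> (('a \<Rightarrow> real) \<Rightarrow> real) \<Rightarrow> 'i filter \<Rightarrow> bool" where
  "weakly_tendsto u T F \<longleftrightarrow>
     (\<forall>f. test_function f \<longrightarrow>
        (\<forall>\<^sub>F i in F. integrable lborel (\<lambda>x. u i x * f x)) \<and>
        ((\<lambda>i. LINT x|lborel. u i x * f x) \<longlongrightarrow> T f) F)"

definition reg_kernel :: "nat \<Rightarrow> real \<Rightarrow> nat \<Rightarrow> real \<Rightarrow> real" where
  "reg_kernel d \<epsilon> n r =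
     (if d = 1 then
        - (1/2) * (\<Sum>l=0..n. ((1/2) gchoose l) * (- (\<epsilon>\<^sup>2)) ^ l
                              * (r\<^sup>2 + \<epsilon>\<^sup>2) powr (1/2 - real l))
      else if d = 2 then
        - (1 / (4 * pi)) * ln (r\<^sup>2 + \<epsilon>\<^sup>2)
        + (1 / (4 * pi)) * (\<Sum>l=1..n. (1 / real l) * \<epsilon> ^ (2 * l) * (r\<^sup>2 + \<epsilon>\<^sup>2) powr (- real l))
      else if d = 3 then
        (1 / (4 * pi)) * (\<Sum>l=0..n. ((- (1/2)) gchoose l) * (- (\<epsilon>\<^sup>2)) ^ l
                                    * (r\<^sup>2 + \<epsilon>\<^sup>2) powr (- (1/2) - real l))
      else undefined)"

end

theory Submission
  imports Defs "HOL-Probability.Distributions"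
begin

text \<open>
  In terms of \<open>s = \<parallel>x\<parallel>\<^sup>2 + \<epsilon>\<^sup>2\<close> the kernel is a sum of powers \<open>s powr (a - l)\<close> with
  \<open>a = 1 - d / 2\<close> (and a logarithm when \<open>d = 2\<close>). For this choice of \<open>a\<close>, the Laplacian of one such
  power is a combination of just two powers, \<open>s powr (a - l - 1)\<close> and \<open>s powr (a - l - 2)\<close>, and the
  coefficients of the kernel are exactly those for which consecutive terms cancel. The sum telescopes
  (\<open>radial_laplacian_telescope\<close>), leaving
  \<open>\<Delta> G = - \<phi>\<close> with \<open>\<phi> x = M\<^sub>n * \<epsilon> ^ (2 * n + 2) * s powr - (n + 1 + d / 2)\<close>
  and \<open>M\<^sub>n = Gamma (n + 1 + d / 2) / (pi powr (d / 2) * n!)\<close>.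

  The function \<open>\<phi>\<close> is positive, and its integral is \<open>1\<close>: writing \<open>Gamma \<alpha> * s powr - \<alpha>\<close> as a Gamma
  integral and exchanging the integrals reduces the integral of \<open>s powr - \<alpha>\<close> over the whole space to
  a Gaussian integral, in every dimension at once (\<open>has_bochner_integral_shifted_power\<close>).

  It remains to see that the mass concentrates at the origin, and for this it suffices that some moment
  \<open>\<integral> \<parallel>x\<parallel> ^ p * \<phi> x dx\<close> tends to \<open>0\<close> (\<open>weak_limit_if_moment_vanishes\<close>). The second moment is
  \<open>\<epsilon>\<^sup>2 * d / (2 * n)\<close>, which settles \<open>n \<longrightarrow> \<infinity>\<close>. It is infinite for \<open>n = 0\<close>, so \<open>\<epsilon> \<longrightarrow> 0\<close> uses the
  first moment, which is at most a constant (depending on \<open>n\<close> and \<open>d\<close>) times \<open>\<epsilon>\<close>.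
\<close>

section \<open>Laplacians of radial functions\<close>

text \<open>The right-hand side is the Laplacian of \<open>\<lambda>x. h (\<parallel>x\<parallel>\<^sup>2 + c)\<close> on a space of dimension \<open>d\<close>, seen
  as a function of \<open>s = \<parallel>x\<parallel>\<^sup>2 + c\<close>. Working with \<open>s\<close> instead of the radius avoids the
  singularity of the norm at the origin and keeps the class closed under sums of powers.\<close>

definition has_radial_laplacian :: "real \<Rightarrow> real \<Rightarrow> (real \<Rightarrow> real) \<Rightarrow> (real \<Rightarrow> real) \<Rightarrow> bool" where
  "has_radial_laplacian d c h g \<longleftrightarrow>
     (\<exists>h' h''. \<forall>s>0. (h has_real_derivative h' s) (at s) \<and>
        (h' has_real_derivative h'' s) (at s) \<and> 2 * d * h' s + 4 * (s - c) * h'' s = g s)"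

text \<open>Along a line in a coordinate direction, \<open>\<parallel>x\<parallel>\<^sup>2\<close> is a quadratic polynomial, so this is the chain
  rule.\<close>

lemma has_derivative_radial_along_basis:
  fixes b x :: "'a::euclidean_space"
  assumes b: "b \<in> Basis" and c: "c > 0"
    and h: "\<And>s. s > 0 \<Longrightarrow> (h has_real_derivative h' s) (at s)"
  shows "((\<lambda>t. h ((norm (x + t *\<^sub>R b))\<^sup>2 + c)) has_real_derivative
           h' ((norm x)\<^sup>2 + c) * (2 * (x \<bullet> b))) (at 0)"
proof -
  have sq: "(norm (x + t *\<^sub>R b))\<^sup>2 = (norm x)\<^sup>2 + 2 * t * (x \<bullet> b) + t\<^sup>2" for t
    unfolding power2_norm_eq_inner using b
    by (simp add: inner_add_left inner_add_right inner_commute power2_eq_square)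
  have "((\<lambda>t. (norm x)\<^sup>2 + 2 * t * (x \<bullet> b) + t\<^sup>2 + c) has_real_derivative 2 * (x \<bullet> b)) (at 0)"
    by (auto intro!: derivative_eq_intros)
  moreover have "(h has_real_derivative h' ((norm x)\<^sup>2 + c)) (at ((norm x)\<^sup>2 + 2 * 0 * (x \<bullet> b) + 0\<^sup>2 + c))"
    using h c by (simp add: add_nonneg_pos)
  ultimately show ?thesis
    unfolding sq by (rule DERIV_chain2 [rotated])
qed

lemma partial_derivative_radial:
  fixes b x :: "'a::euclidean_space"
  assumes b: "b \<in> Basis" and c: "c > 0"
    and h: "\<And>s. s > 0 \<Longrightarrow> (h has_real_derivative h' s) (at s)"
  shows "partial_derivative b (\<lambda>x. h ((norm x)\<^sup>2 + c)) x = 2 * (x \<bullet> b) * h' ((norm x)\<^sup>2 + c)"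
  using has_derivative_radial_along_basis [OF b c h, of x]
  unfolding partial_derivative_def by (simp add: DERIV_imp_deriv)

text \<open>The function differentiated here has the form of a first partial derivative of a radial
  function, so this gives the second one.\<close>

lemma partial_derivative_component_times_radial:
  fixes b x :: "'a::euclidean_space"
  assumes b: "b \<in> Basis" and c: "c > 0"
    and h: "\<And>s. s > 0 \<Longrightarrow> (h has_real_derivative h' s) (at s)"
  shows "partial_derivative b (\<lambda>x. 2 * (x \<bullet> b) * h ((norm x)\<^sup>2 + c)) x
           = 2 * h ((norm x)\<^sup>2 + c) + 4 * (x \<bullet> b)\<^sup>2 * h' ((norm x)\<^sup>2 + c)"
proof -
  have "((\<lambda>t. 2 * ((x + t *\<^sub>R b) \<bullet> b)) has_real_derivative 2) (at 0)"
    using b by (auto intro!: derivative_eq_intros simp: inner_add_left)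
  from DERIV_mult [OF this has_derivative_radial_along_basis [OF b c h, of x]] show ?thesis
    unfolding partial_derivative_def by (subst DERIV_imp_deriv) (auto simp: power2_eq_square mult_ac)
qed

lemma laplacian_radial:
  fixes x :: "'a::euclidean_space"
  assumes lap: "has_radial_laplacian (real DIM('a)) c h g" and c: "c > 0"
  shows "laplacian (\<lambda>x::'a. h ((norm x)\<^sup>2 + c)) x = g ((norm x)\<^sup>2 + c)"
proof -
  obtain h' h'' where h: "\<And>s. s > 0 \<Longrightarrow> (h has_real_derivative h' s) (at s)"
    and h': "\<And>s. s > 0 \<Longrightarrow> (h' has_real_derivative h'' s) (at s)"
    and g: "\<And>s. s > 0 \<Longrightarrow> 2 * real DIM('a) * h' s + 4 * (s - c) * h'' s = g s"
    using lap unfolding has_radial_laplacian_def by blast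
  define s where "s = (norm x)\<^sup>2 + c"
  have "laplacian (\<lambda>x. h ((norm x)\<^sup>2 + c)) x = (\<Sum>b\<in>Basis. 2 * h' s + 4 * (x \<bullet> b)\<^sup>2 * h'' s)"
    unfolding laplacian_def s_def
  proof (rule sum.cong)
    fix b :: 'a assume b: "b \<in> Basis"
    have "partial_derivative b (\<lambda>x. h ((norm x)\<^sup>2 + c)) = (\<lambda>x. 2 * (x \<bullet> b) * h' ((norm x)\<^sup>2 + c))"
      using partial_derivative_radial [OF b c h] by (intro ext)
    then show "partial_derivative b (partial_derivative b (\<lambda>x. h ((norm x)\<^sup>2 + c))) x
        = 2 * h' ((norm x)\<^sup>2 + c) + 4 * (x \<bullet> b)\<^sup>2 * h'' ((norm x)\<^sup>2 + c)"
      using partial_derivative_component_times_radial [OF b c h'] by simp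
  qed simp
  also have "\<dots> = 2 * real DIM('a) * h' s + 4 * (\<Sum>b\<in>Basis. (x \<bullet> b)\<^sup>2) * h'' s"
    by (simp add: sum.distrib sum_distrib_left sum_distrib_right)
  also have "(\<Sum>b\<in>Basis. (x \<bullet> b)\<^sup>2) = s - c"
    unfolding s_def power2_norm_eq_inner by (simp add: euclidean_inner[of x x] power2_eq_square)
  also have "2 * real DIM('a) * h' s + 4 * (s - c) * h'' s = g s"
    using c by (intro g) (simp add: s_def add_nonneg_pos)
  finally show ?thesis
    by (simp add: s_def)
qed

lemma has_radial_laplacian_add:
  assumes "has_radial_laplacian d c h1 g1" "has_radial_laplacian d c h2 g2"
    and "\<And>s. s > 0 \<Longrightarrow> g1 s + g2 s = g s"
  shows "has_radial_laplacian d c (\<lambda>s. h1 s + h2 s) g"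
proof -
  obtain p p' where p:
    "\<And>s. s > 0 \<Longrightarrow> (h1 has_real_derivative p s) (at s)"
    "\<And>s. s > 0 \<Longrightarrow> (p has_real_derivative p' s) (at s)"
    "\<And>s. s > 0 \<Longrightarrow> 2 * d * p s + 4 * (s - c) * p' s = g1 s"
    using assms(1) unfolding has_radial_laplacian_def by blast
  obtain q q' where q:
    "\<And>s. s > 0 \<Longrightarrow> (h2 has_real_derivative q s) (at s)"
    "\<And>s. s > 0 \<Longrightarrow> (q has_real_derivative q' s) (at s)"
    "\<And>s. s > 0 \<Longrightarrow> 2 * d * q s + 4 * (s - c) * q' s = g2 s"
    using assms(2) unfolding has_radial_laplacian_def by blast
  show ?thesis
    unfolding has_radial_laplacian_def
  proof (intro exI allI impI conjI)
    fix s :: real assume s: "s > 0"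
    show "((\<lambda>s. h1 s + h2 s) has_real_derivative p s + q s) (at s)"
      by (intro DERIV_add p q s)
    show "((\<lambda>s. p s + q s) has_real_derivative p' s + q' s) (at s)"
      by (intro DERIV_add p q s)
    show "2 * d * (p s + q s) + 4 * (s - c) * (p' s + q' s) = g s"
      using p(3) [OF s] q(3) [OF s] assms(3) [OF s] by (simp add: distrib_left)
  qed
qed

text \<open>Splitting \<open>4 * (s - c)\<close> into \<open>4 * s\<close> and \<open>- 4 * c\<close> separates the two powers. With
  \<open>p = 1 - d / 2 - l\<close> the coefficient \<open>2 * d + 4 * (p - 1)\<close> of the first collapses to \<open>- 4 * l\<close>; this
  is what makes the terms of the kernel telescope.\<close>

lemma has_radial_laplacian_powr:
  assumes p: "\<And>s. s > 0 \<Longrightarrow>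
     k * p * ((2 * d + 4 * (p - 1)) * s powr (p - 1) - 4 * c * (p - 1) * s powr (p - 2)) = g s"
  shows "has_radial_laplacian d c (\<lambda>s. k * s powr p) g"
  unfolding has_radial_laplacian_def
proof (intro exI allI impI conjI)
  fix s :: real assume s: "s > 0"
  show "((\<lambda>s. k * s powr p) has_real_derivative k * p * s powr (p - 1)) (at s)"
    using s by (auto intro!: derivative_eq_intros)
  show "((\<lambda>s. k * p * s powr (p - 1)) has_real_derivative k * p * (p - 1) * s powr (p - 2)) (at s)"
    using s by (auto intro!: derivative_eq_intros)
  have "s * s powr (p - 2) = s powr (p - 1)"
    using s powr_add [of s 1 "p - 2"] by (simp add: add.commute)
  then have "(s - c) * s powr (p - 2) = s powr (p - 1) - c * s powr (p - 2)"
    by (simp add: left_diff_distrib)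
  moreover have "2 * d * (k * p * P) + 4 * (s - c) * (k * p * (p - 1) * Q)
      = k * p * ((2 * d + 4 * (p - 1)) * P - 4 * c * (p - 1) * Q)"
    if "(s - c) * Q = P - c * Q" for P Q
    using that by algebra
  ultimately show "2 * d * (k * p * s powr (p - 1)) + 4 * (s - c) * (k * p * (p - 1) * s powr (p - 2)) = g s"
    unfolding p [OF s, symmetric] by blast
qed

section \<open>The Laplacian of the kernel telescopes\<close>

text \<open>The factor that gives \<open>(\<parallel>x\<parallel>\<^sup>2 + 1) powr - (n + 1 + d / 2)\<close> unit mass in dimension \<open>d\<close>.\<close>

definition blob_const :: "real \<Rightarrow> nat \<Rightarrow> real" where
  "blob_const d n = Gamma (real n + 1 + d / 2) / (pi powr (d / 2) * fact n)"

lemma blob_const_Suc: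
  assumes "d \<ge> 0"
  shows "blob_const d (Suc n) = blob_const d n * (real n + 1 + d / 2) / (real n + 1)"
proof -
  have "real n + 1 + d / 2 > 0"
    using assms by (simp add: add_pos_nonneg)
  then have "real n + 1 + d / 2 \<notin> \<int>\<^sub>\<le>\<^sub>0"
    by (auto elim!: nonpos_Ints_cases)
  then have "Gamma (real (Suc n) + 1 + d / 2) = (real n + 1 + d / 2) * Gamma (real n + 1 + d / 2)"
    using Gamma_plus1 [of "real n + 1 + d / 2"] by (simp add: ac_simps)
  then show ?thesis
    by (simp add: blob_const_def ac_simps)
qed

text \<open>The condition on \<open>b\<close> says that the first of the two powers in the Laplacian of the new term
  cancels the remainder left by the previous terms. Up to the sign and the power of \<open>e\<close>, the new
  remainder is \<open>4 * b l * (l - a) * (l + 1 - a)\<close> times the second power, and by the functional equation of \<open>Gamma\<close>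
  this is the next normalising constant, because \<open>1 - a = d / 2\<close>.\<close>

lemma radial_laplacian_telescope:
  fixes d e :: real
  assumes d: "d \<ge> 0" and a: "a = 1 - d / 2"
    and base: "has_radial_laplacian d (e\<^sup>2) h0 (\<lambda>s. - blob_const d 0 * e\<^sup>2 * s powr - (1 + d / 2))"
    and b: "\<And>l. 4 * real (Suc l) * (real (Suc l) - a) * b (Suc l) = blob_const d l"
  shows "has_radial_laplacian d (e\<^sup>2)
           (\<lambda>s. h0 s + (\<Sum>l=1..n. b l * e ^ (2 * l) * s powr (a - real l)))
           (\<lambda>s. - blob_const d n * e ^ (2 * n + 2) * s powr - (real n + 1 + d / 2))"
proof (induction n)
  case 0
  then show ?case
    using base by (simp add: power2_eq_square)
next
  case (Suc n)
  define l where "l = real (Suc n)"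
  define B where "B = b (Suc n)"
  have l: "l > 0" "real n = l - 1"
    by (simp_all add: l_def)
  have M: "blob_const d n = 4 * l * (l - a) * B"
    using b [of n] by (simp add: l_def B_def)
  have M': "blob_const d (Suc n) = 4 * (l - a) * (l + 1 - a) * B"
    unfolding blob_const_Suc [OF d] M using l by (simp add: a field_simps)
  have "has_radial_laplacian d (e\<^sup>2) (\<lambda>s. (B * e ^ (2 * Suc n)) * s powr (a - l))
      (\<lambda>s. blob_const d n * e ^ (2 * n + 2) * s powr - (real n + 1 + d / 2)
           - blob_const d (Suc n) * e ^ (2 * Suc n + 2) * s powr - (real (Suc n) + 1 + d / 2))"
  proof (rule has_radial_laplacian_powr)
    fix s :: real
    have e: "- (real n + 1 + d / 2) = a - l - 1" "- (real (Suc n) + 1 + d / 2) = a - l - 2"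
      by (simp_all add: l_def a)
    have d': "2 * d = 4 - 4 * a"
      by (simp add: a)
    have ring: "B * E * (a - l) * ((4 - 4 * a + 4 * (a - l - 1)) * P - 4 * c * (a - l - 1) * Q)
        = 4 * l * (l - a) * B * E * P - 4 * (l - a) * (l + 1 - a) * B * (c * E) * Q" for E P Q c
      by algebra
    have pw: "e ^ (2 * Suc n + 2) = e\<^sup>2 * e ^ (2 * Suc n)" "e ^ (2 * n + 2) = e ^ (2 * Suc n)"
      by (simp_all add: power2_eq_square)
    show "B * e ^ (2 * Suc n) * (a - l) * ((2 * d + 4 * (a - l - 1)) * s powr (a - l - 1)
          - 4 * e\<^sup>2 * (a - l - 1) * s powr (a - l - 2))
        = blob_const d n * e ^ (2 * n + 2) * s powr - (real n + 1 + d / 2)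
           - blob_const d (Suc n) * e ^ (2 * Suc n + 2) * s powr - (real (Suc n) + 1 + d / 2)"
      unfolding e M M' pw d' by (rule ring)
  qed
  note step = has_radial_laplacian_add [OF Suc.IH this]
  have sum: "(\<lambda>s. h0 s + (\<Sum>l=1..Suc n. b l * e ^ (2 * l) * s powr (a - real l)))
      = (\<lambda>s. (h0 s + (\<Sum>l=1..n. b l * e ^ (2 * l) * s powr (a - real l)))
            + (B * e ^ (2 * Suc n)) * s powr (a - l))"
    unfolding l_def B_def by (intro ext) (simp add: sum.cl_ivl_Suc add.assoc del: power_Suc)
  show ?case
    unfolding sum by (rule step) simp
qed

text \<open>With \<open>b l = \<kappa> * (a gchoose l) * (-1) ^ l\<close>, the recursion
  \<open>(l + 1) * (a gchoose (l + 1)) = (a - l) * (a gchoose l)\<close> carries the cancellation condition from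
  one term to the next; only the prefactor \<open>\<kappa>\<close> of the first term has to be matched to the dimension.\<close>

lemma binomial_kernel_laplacian:
  fixes d e \<kappa> :: real
  assumes d: "d \<ge> 0" and a: "a = 1 - d / 2"
    and \<kappa>: "4 * (1 - a) * (- a) * \<kappa> = blob_const d 0"
  shows "has_radial_laplacian d (e\<^sup>2)
           (\<lambda>s. \<kappa> * (\<Sum>l=0..n. (a gchoose l) * (- (e\<^sup>2)) ^ l * s powr (a - real l)))
           (\<lambda>s. - blob_const d n * e ^ (2 * n + 2) * s powr - (real n + 1 + d / 2))"
proof -
  define b where "b l = \<kappa> * (a gchoose l) * (-1) ^ l" for l
  have b_Suc: "real (Suc l) * b (Suc l) = (real l - a) * b l" for l
  proof -
    have "real (Suc l) * b (Suc l) = - \<kappa> * (-1) ^ l * (real (Suc l) * (a gchoose Suc l))"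
      by (simp add: b_def)
    also have "real (Suc l) * (a gchoose Suc l) = (a - real l) * (a gchoose l)"
      using gbinomial_mult_1 [of a l] by (simp add: algebra_simps)
    finally show ?thesis
      by (simp add: b_def algebra_simps)
  qed
  have b: "4 * real (Suc l) * (real (Suc l) - a) * b (Suc l) = blob_const d l" for l
  proof (induction l)
    case 0
    show ?case
      unfolding \<kappa> [symmetric] by (simp add: b_def)
  next
    case (Suc l)
    have "4 * real (Suc (Suc l)) * (real (Suc (Suc l)) - a) * b (Suc (Suc l))
        = 4 * (real (Suc (Suc l)) - a) * ((real (Suc l) - a) * b (Suc l))"
      unfolding b_Suc [symmetric] by (simp only: mult_ac)
    also have "\<dots> = blob_const d l * (real (Suc l) + 1 - a) / real (Suc l)"
      unfolding Suc.IH [symmetric] by (simp add: field_simps)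
    also have "\<dots> = blob_const d (Suc l)"
      unfolding blob_const_Suc [OF d] by (simp add: a add_ac)
    finally show ?case .
  qed
  have base: "has_radial_laplacian d (e\<^sup>2) (\<lambda>s. \<kappa> * s powr a)
      (\<lambda>s. - blob_const d 0 * e\<^sup>2 * s powr - (1 + d / 2))"
  proof (rule has_radial_laplacian_powr)
    fix s :: real
    have e: "- (1 + d / 2) = a - 2" "2 * d = 4 - 4 * a"
      by (simp_all add: a)
    show "\<kappa> * a * ((2 * d + 4 * (a - 1)) * s powr (a - 1) - 4 * e\<^sup>2 * (a - 1) * s powr (a - 2))
        = - blob_const d 0 * e\<^sup>2 * s powr - (1 + d / 2)"
      unfolding e \<kappa> [symmetric] by (simp add: algebra_simps)
  qed
  have sign: "(- (e\<^sup>2)) ^ l = (-1) ^ l * e ^ (2 * l)" for l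
    by (simp only: power_minus [of "e\<^sup>2"] power_mult)
  have "(\<Sum>l=0..n. (a gchoose l) * (- (e\<^sup>2)) ^ l * s powr (a - real l))
      = s powr a + (\<Sum>l=1..n. (a gchoose l) * (- (e\<^sup>2)) ^ l * s powr (a - real l))" for s
    by (simp add: sum.atLeast_Suc_atMost)
  then have "\<kappa> * (\<Sum>l=0..n. (a gchoose l) * (- (e\<^sup>2)) ^ l * s powr (a - real l))
      = \<kappa> * s powr a + (\<Sum>l=1..n. b l * e ^ (2 * l) * s powr (a - real l))" for s
    unfolding sign by (simp add: b_def distrib_left sum_distrib_left mult_ac)
  then show ?thesis
    using radial_laplacian_telescope [OF d a base b] by simp
qed

text \<open>In the plane \<open>a = 0\<close>: the logarithm takes the place of the power \<open>s powr a\<close>, which is now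
  constant, and the telescoping starts from it.\<close>

lemma logarithmic_kernel_laplacian:
  fixes e :: real
  shows "has_radial_laplacian 2 (e\<^sup>2)
           (\<lambda>s. - (1 / (4 * pi)) * ln s
              + (1 / (4 * pi)) * (\<Sum>l=1..n. (1 / real l) * e ^ (2 * l) * s powr (- real l)))
           (\<lambda>s. - blob_const 2 n * e ^ (2 * n + 2) * s powr - (real n + 1 + 2 / 2))"
proof -
  have M: "blob_const 2 l = real (Suc l) / pi" for l
    using Gamma_fact [of "Suc l", where 'a = real] by (simp add: blob_const_def add_ac)
  have base: "has_radial_laplacian 2 (e\<^sup>2) (\<lambda>s. - (1 / (4 * pi)) * ln s)
      (\<lambda>s. - blob_const 2 0 * e\<^sup>2 * s powr - (1 + 2 / 2))"
    unfolding has_radial_laplacian_def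
  proof (intro exI allI impI conjI)
    fix s :: real assume s: "s > 0"
    show "((\<lambda>s. - (1 / (4 * pi)) * ln s) has_real_derivative - (1 / (4 * pi)) / s) (at s)"
      using s by (auto intro!: derivative_eq_intros)
    show "((\<lambda>s. - (1 / (4 * pi)) / s) has_real_derivative (1 / (4 * pi)) / s\<^sup>2) (at s)"
      using s by (auto intro!: derivative_eq_intros simp: power2_eq_square)
    have "s powr - (1 + 2 / 2) = 1 / s\<^sup>2"
      using s by (simp add: powr_minus divide_inverse)
    then show "2 * 2 * (- (1 / (4 * pi)) / s) + 4 * (s - e\<^sup>2) * (1 / (4 * pi) / s\<^sup>2)
        = - blob_const 2 0 * e\<^sup>2 * s powr - (1 + 2 / 2)"
      using s by (simp add: M field_simps power2_eq_square)
  qed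
  have "has_radial_laplacian 2 (e\<^sup>2)
      (\<lambda>s. - (1 / (4 * pi)) * ln s
           + (\<Sum>l=1..n. (1 / (4 * pi * real l)) * e ^ (2 * l) * s powr (0 - real l)))
      (\<lambda>s. - blob_const 2 n * e ^ (2 * n + 2) * s powr - (real n + 1 + 2 / 2))"
    by (rule radial_laplacian_telescope [OF _ _ base]) (simp_all add: M del: of_nat_Suc)
  then show ?thesis
    by (simp add: sum_distrib_left)
qed

section \<open>Integrals of shifted powers\<close>

lemma nn_integral_gaussian:
  fixes t :: real
  assumes t: "t > 0"
  shows "(\<integral>\<^sup>+y. ennreal (exp (- t * y\<^sup>2)) \<partial>lborel) = ennreal (sqrt (pi / t))"
proof -
  \<comment> \<open>the standard deviation of the normal density proportional to \<open>exp (- t * y\<^sup>2)\<close>\<close>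
  define s where "s = sqrt (1 / (2 * t))"
  have s: "s > 0" "s\<^sup>2 = 1 / (2 * t)"
    using t by (auto simp: s_def)
  have dens: "exp (- t * y\<^sup>2) = sqrt (pi / t) * normal_density 0 s y" for y
    using t by (simp add: normal_density_def s field_simps real_sqrt_divide real_sqrt_mult)
  have "(\<integral>\<^sup>+y. ennreal (normal_density 0 s y) \<partial>lborel) = 1"
    using s by (subst nn_integral_eq_integral) auto
  moreover have "(\<integral>\<^sup>+y. ennreal (exp (- t * y\<^sup>2)) \<partial>lborel)
      = ennreal (sqrt (pi / t)) * (\<integral>\<^sup>+y. ennreal (normal_density 0 s y) \<partial>lborel)"
    unfolding dens using t by (subst nn_integral_cmult [symmetric]) (auto simp: ennreal_mult')
  ultimately show ?thesis
    by simp
qed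

lemma nn_integral_gaussian_euclidean:
  fixes t :: real
  assumes t: "t > 0"
  shows "(\<integral>\<^sup>+x. ennreal (exp (- t * (norm (x :: 'a::euclidean_space))\<^sup>2)) \<partial>lborel)
           = ennreal ((pi / t) powr (real DIM('a) / 2))"
proof -
  have "(\<integral>\<^sup>+x. ennreal (exp (- t * (norm (x :: 'a))\<^sup>2)) \<partial>lborel)
      = (\<integral>\<^sup>+x. (\<Prod>b\<in>Basis. ennreal (exp (- t * ((x::'a) \<bullet> b)\<^sup>2))) \<partial>lborel)"
  proof (intro nn_integral_cong)
    fix x :: 'a
    have "(norm x)\<^sup>2 = (\<Sum>b\<in>Basis. (x \<bullet> b)\<^sup>2)"
      unfolding power2_norm_eq_inner by (simp add: euclidean_inner[of x x] power2_eq_square)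
    then show "ennreal (exp (- t * (norm x)\<^sup>2)) = (\<Prod>b\<in>Basis. ennreal (exp (- t * (x \<bullet> b)\<^sup>2)))"
      by (simp add: prod_ennreal sum_distrib_left sum_negf [symmetric] exp_sum del: sum_negf)
  qed
  also have "\<dots> = (\<Prod>b\<in>(Basis::'a set). (\<integral>\<^sup>+y. ennreal (exp (- t * y\<^sup>2)) \<partial>lborel))"
    by (rule nn_integral_lborel_prod) auto
  also have "\<dots> = ennreal (sqrt (pi / t) ^ DIM('a))"
    using t by (simp add: nn_integral_gaussian [simplified] ennreal_power)
  also have "sqrt (pi / t) ^ DIM('a) = (pi / t) powr (real DIM('a) / 2)"
    using t by (simp add: powr_half_sqrt [symmetric] powr_powr powr_realpow [symmetric])
  finally show ?thesis .
qed

lemma nn_integral_Gamma_scaled: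
  fixes z s :: real
  assumes z: "z > 0" and s: "s > 0"
  shows "(\<integral>\<^sup>+t. ennreal (indicator {0<..} t * t powr (z - 1) * exp (- s * t)) \<partial>lborel)
           = ennreal (Gamma z * s powr - z)"
proof -
  have "ennreal (Gamma z) = (\<integral>\<^sup>+t. ennreal (indicator {0..} t * t powr (z - 1) / exp t) \<partial>lborel)"
    by (rule Gamma_conv_nn_integral_real [OF z])
  also have "\<dots> = ennreal \<bar>s\<bar> *
      (\<integral>\<^sup>+t. ennreal (indicator {0..} (0 + s * t) * (0 + s * t) powr (z - 1) / exp (0 + s * t)) \<partial>lborel)"
    using s by (subst nn_integral_real_affine [where c = s and t = 0]) auto
  also have "(\<integral>\<^sup>+t. ennreal (indicator {0..} (0 + s * t) * (0 + s * t) powr (z - 1) / exp (0 + s * t)) \<partial>lborel)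
      = (\<integral>\<^sup>+t. ennreal (s powr (z - 1)) *
            ennreal (indicator {0<..} t * t powr (z - 1) * exp (- s * t)) \<partial>lborel)"
    using s
    by (intro nn_integral_cong)
       (auto simp: indicator_def powr_mult exp_minus divide_simps ennreal_mult' [symmetric]
          zero_le_mult_iff)
  also have "ennreal \<bar>s\<bar> * \<dots> = ennreal (s powr z) *
      (\<integral>\<^sup>+t. ennreal (indicator {0<..} t * t powr (z - 1) * exp (- s * t)) \<partial>lborel)"
    using s by (subst nn_integral_cmult)
      (auto simp: mult.assoc [symmetric] ennreal_mult' [symmetric] powr_diff)
  finally have eq: "ennreal (Gamma z) = ennreal (s powr z) *
      (\<integral>\<^sup>+t. ennreal (indicator {0<..} t * t powr (z - 1) * exp (- s * t)) \<partial>lborel)" .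
  have "ennreal (s powr - z) * ennreal (Gamma z) =
      (\<integral>\<^sup>+t. ennreal (indicator {0<..} t * t powr (z - 1) * exp (- s * t)) \<partial>lborel)"
    unfolding eq using s
    by (simp add: mult.assoc [symmetric] ennreal_mult' [symmetric] powr_minus)
  then show ?thesis
    using s z by (simp add: ennreal_mult' ac_simps)
qed

text \<open>Writing \<open>Gamma \<alpha> * s powr - \<alpha>\<close> as the integral of \<open>t powr (\<alpha> - 1) * exp (- s * t)\<close> makes the
  dependence on \<open>x\<close> Gaussian. By Tonelli the integral over \<open>x\<close> can be done first; it contributes
  \<open>(pi / t) powr (d / 2)\<close>, and what remains is the Gamma integral for \<open>\<alpha> - d / 2\<close>.\<close>

lemma has_bochner_integral_shifted_power:
  fixes \<alpha> c :: real
  assumes \<alpha>: "\<alpha> > real DIM('a) / 2" and c: "c > 0"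
  shows "has_bochner_integral lborel (\<lambda>x::'a::euclidean_space. ((norm x)\<^sup>2 + c) powr - \<alpha>)
           (pi powr (real DIM('a) / 2) * Gamma (\<alpha> - real DIM('a) / 2) / Gamma \<alpha>
              * c powr (real DIM('a) / 2 - \<alpha>))"
proof -
  define k where "k = real DIM('a) / 2"
  have k: "k \<ge> 0" "\<alpha> > k" "\<alpha> > 0" 
    using \<alpha> by (auto simp: k_def intro: order.strict_trans1 [OF _ \<alpha>])
  have G: "Gamma \<alpha> > 0" "Gamma (\<alpha> - k) > 0"
    using k by auto
  let ?w = "\<lambda>t::real. indicator {0<..} t * t powr (\<alpha> - 1) :: real"
  have pos: "(norm (x::'a))\<^sup>2 + c > 0" for x
    using c by (simp add: add_nonneg_pos)
  have "ennreal (Gamma \<alpha>) * (\<integral>\<^sup>+x. ennreal (((norm (x::'a))\<^sup>2 + c) powr - \<alpha>) \<partial>lborel)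
      = (\<integral>\<^sup>+x. ennreal (Gamma \<alpha> * ((norm (x::'a))\<^sup>2 + c) powr - \<alpha>) \<partial>lborel)"
    using G by (subst nn_integral_cmult [symmetric]) (auto simp: ennreal_mult')
  also have "\<dots> = (\<integral>\<^sup>+(x::'a). (\<integral>\<^sup>+t. ennreal (?w t * exp (- ((norm x)\<^sup>2 + c) * t)) \<partial>lborel) \<partial>lborel)"
    using k pos by (intro nn_integral_cong) (subst nn_integral_Gamma_scaled, auto)
  also have "\<dots> = (\<integral>\<^sup>+t. (\<integral>\<^sup>+(x::'a). ennreal (?w t * exp (- ((norm x)\<^sup>2 + c) * t)) \<partial>lborel) \<partial>lborel)"
    by (rule lborel_pair.Fubini') (auto simp: case_prod_unfold)
  also have "\<dots> = (\<integral>\<^sup>+t. ennreal (pi powr k) *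
      ennreal (indicator {0<..} t * t powr (\<alpha> - k - 1) * exp (- c * t)) \<partial>lborel)"
  proof (intro nn_integral_cong)
    fix t :: real
    show "(\<integral>\<^sup>+(x::'a). ennreal (?w t * exp (- ((norm x)\<^sup>2 + c) * t)) \<partial>lborel)
        = ennreal (pi powr k) * ennreal (indicator {0<..} t * t powr (\<alpha> - k - 1) * exp (- c * t))"
    proof (cases "t > 0")
      case True
      have "(\<integral>\<^sup>+(x::'a). ennreal (?w t * exp (- ((norm x)\<^sup>2 + c) * t)) \<partial>lborel)
          = (\<integral>\<^sup>+(x::'a). ennreal (t powr (\<alpha> - 1) * exp (- c * t)) * ennreal (exp (- t * (norm x)\<^sup>2)) \<partial>lborel)"
        using True by (intro nn_integral_cong)
          (simp add: ennreal_mult' [symmetric] exp_add [symmetric] algebra_simps flip: exp_add)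
      also have "\<dots> = ennreal (t powr (\<alpha> - 1) * exp (- c * t)) * ennreal ((pi / t) powr k)"
        using True by (subst nn_integral_cmult) (auto simp: nn_integral_gaussian_euclidean [simplified] k_def)
      also have "\<dots> = ennreal (pi powr k) * ennreal (t powr (\<alpha> - k - 1) * exp (- c * t))"
        using True by (simp add: ennreal_mult' [symmetric] powr_divide powr_diff powr_add field_simps)
      finally show ?thesis
        using True by simp
    qed auto
  qed
  also have "\<dots> = ennreal (pi powr k) * ennreal (Gamma (\<alpha> - k) * c powr - (\<alpha> - k))"
    using k c by (subst nn_integral_cmult) (auto simp: nn_integral_Gamma_scaled [simplified])
  also have "\<dots> = ennreal (Gamma \<alpha>) * ennreal (pi powr k * Gamma (\<alpha> - k) / Gamma \<alpha> * c powr (k - \<alpha>))"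
    using G by (simp add: ennreal_mult' [symmetric])
  finally have "(\<integral>\<^sup>+x. ennreal (((norm (x::'a))\<^sup>2 + c) powr - \<alpha>) \<partial>lborel)
      = ennreal (pi powr k * Gamma (\<alpha> - k) / Gamma \<alpha> * c powr (k - \<alpha>))"
    using G by (simp add: ennreal_mult_cancel_left)
  then show ?thesis
    unfolding k_def [symmetric] using G by (intro has_bochner_integral_nn_integral) auto
qed

section \<open>Concentration at the origin\<close>

text \<open>Near the origin \<open>f x\<close> is close to \<open>f 0\<close> by continuity; at distance at least \<open>\<delta>\<close> the difference
  is at most \<open>2 * B \<le> 2 * B * (\<parallel>x\<parallel> / \<delta>) ^ p\<close>. Integrating against \<open>\<phi>\<close>, the second contribution is
  controlled by the moment, so that no separate estimate of the tails is needed.\<close>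

lemma weak_limit_if_moment_vanishes:
  fixes \<phi> :: "'i \<Rightarrow> 'a::euclidean_space \<Rightarrow> real" and f :: "'a \<Rightarrow> real"
  assumes nonneg: "\<And>i x. \<phi> i x \<ge> 0"
    and mass: "\<forall>\<^sub>F i in F. has_bochner_integral lborel (\<phi> i) 1"
    and moment: "\<forall>\<^sub>F i in F. integrable lborel (\<lambda>x. norm x ^ p * \<phi> i x)
                   \<and> (LINT x|lborel. norm x ^ p * \<phi> i x) \<le> m i"
    and m: "(m \<longlongrightarrow> 0) F"
    and cont: "continuous_on UNIV f" and bdd: "\<And>x. \<bar>f x\<bar> \<le> B"
  shows "(\<forall>\<^sub>F i in F. integrable lborel (\<lambda>x. \<phi> i x * f x)) \<and>
         ((\<lambda>i. LINT x|lborel. \<phi> i x * f x) \<longlongrightarrow> f 0) F"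
proof
  have [measurable]: "f \<in> borel_measurable borel"
    using cont by (rule borel_measurable_continuous_onI)
  have B: "B \<ge> 0"
    using bdd [of 0] by linarith
  have int_f: "integrable lborel (\<lambda>x. \<phi> i x * f x)"
    if "has_bochner_integral lborel (\<phi> i) 1" for i
  proof (rule Bochner_Integration.integrable_bound)
    show "integrable lborel (\<lambda>x. B * \<phi> i x)"
      using that by (auto simp: has_bochner_integral_iff)
    then show "(\<lambda>x. \<phi> i x * f x) \<in> borel_measurable lborel"
      using that by (auto simp: has_bochner_integral_iff)
    show "AE x in lborel. norm (\<phi> i x * f x) \<le> norm (B * \<phi> i x)"
      using nonneg bdd B by (auto simp: abs_mult mult.commute intro!: mult_right_mono)
  qed
  show "\<forall>\<^sub>F i in F. integrable lborel (\<lambda>x. \<phi> i x * f x)"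
    using mass by (rule eventually_mono) (rule int_f)
  show "((\<lambda>i. LINT x|lborel. \<phi> i x * f x) \<longlongrightarrow> f 0) F"
  proof (rule tendstoI)
    fix \<eta> :: real assume \<eta>: "\<eta> > 0"
    obtain \<delta> where \<delta>: "\<delta> > 0" "\<And>x. norm x < \<delta> \<Longrightarrow> \<bar>f x - f 0\<bar> < \<eta> / 2"
      using cont \<eta> unfolding continuous_on_iff
      by (metis UNIV_I dist_0_norm dist_commute dist_real_def half_gt_zero)
    define C where "C = 2 * B / \<delta> ^ p"
    have C: "C \<ge> 0"
      using B \<delta> by (simp add: C_def)
    have pointwise: "\<bar>f x - f 0\<bar> \<le> \<eta> / 2 + C * norm x ^ p" for x
    proof (cases "norm x < \<delta>")
      case True
      then show ?thesis
        using \<delta>(2) [OF True] C by (smt (verit) mult_nonneg_nonneg norm_ge_zero zero_le_power)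
    next
      case False
      then have "2 * B \<le> C * norm x ^ p"
        using \<delta> B by (simp add: C_def divide_simps mult_left_mono power_mono)
      then show ?thesis
        using bdd [of x] bdd [of 0] \<eta> by linarith
    qed
    have "((\<lambda>i. \<eta> / 2 + C * m i) \<longlongrightarrow> \<eta> / 2 + C * 0) F"
      by (intro tendsto_intros m)
    then have "\<forall>\<^sub>F i in F. \<eta> / 2 + C * m i < \<eta>"
      by (rule order_tendstoD) (use \<eta> in simp)
    with mass moment show "\<forall>\<^sub>F i in F. dist (LINT x|lborel. \<phi> i x * f x) (f 0) < \<eta>"
    proof eventually_elim
      case (elim i)
      have int: "integrable lborel (\<phi> i)" "integral\<^sup>L lborel (\<phi> i) = 1"
        using elim(1) by (auto simp: has_bochner_integral_iff)
      have "(LINT x|lborel. \<phi> i x * f x) - f 0 = (LINT x|lborel. \<phi> i x * f x - \<phi> i x * f 0)"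
        using int int_f [OF elim(1)] by simp
      also have "\<bar>\<dots>\<bar> \<le> (LINT x|lborel. \<eta> / 2 * \<phi> i x + C * (norm x ^ p * \<phi> i x))"
      proof (rule integral_abs_bound [THEN order_trans], rule integral_mono)
        show "\<bar>\<phi> i x * f x - \<phi> i x * f 0\<bar> \<le> \<eta> / 2 * \<phi> i x + C * (norm x ^ p * \<phi> i x)" for x
          using mult_left_mono [OF pointwise [of x] nonneg [of i x]] nonneg [of i x]
          by (simp add: distrib_left mult_ac abs_mult flip: right_diff_distrib left_diff_distrib)
      qed (use int int_f [OF elim(1)] elim(2) in auto)
      also have "\<dots> = \<eta> / 2 + C * (LINT x|lborel. norm x ^ p * \<phi> i x)"
        using int elim(2) by simp
      also have "\<dots> \<le> \<eta> / 2 + C * m i"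
        using elim(2) C by (auto intro: mult_left_mono)
      finally show ?case
        using elim(3) by (simp add: dist_real_def)
    qed
  qed
qed

lemma test_function_bounded:
  assumes "test_function f"
  obtains B where "\<And>x. \<bar>f x\<bar> \<le> B"
proof -
  have cont: "continuous_on UNIV f" and supp: "compact (closure {x. f x \<noteq> 0})"
    using assms by (auto simp: test_function_def dest: spec [of _ 0])
  have "compact (f ` closure {x. f x \<noteq> 0})"
    using supp cont by (intro compact_continuous_image) (auto intro: continuous_on_subset)
  then obtain B where B: "\<And>y. y \<in> f ` closure {x. f x \<noteq> 0} \<Longrightarrow> \<bar>y\<bar> \<le> B"
    by (metis compact_imp_bounded bounded_iff real_norm_def)
  have "\<bar>f x\<bar> \<le> max B 0" for x
    using B [of "f x"] closure_subset [of "{x. f x \<noteq> 0}"] by (cases "f x = 0") force+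
  then show ?thesis
    by (rule that)
qed

lemma weakly_tendsto_minus_dirac_delta:
  fixes u :: "'i \<Rightarrow> 'a::euclidean_space \<Rightarrow> real"
  assumes u: "\<forall>\<^sub>F i in F. \<forall>x. u i x = - \<phi> i x"
    and nonneg: "\<And>i x. \<phi> i x \<ge> 0"
    and mass: "\<forall>\<^sub>F i in F. has_bochner_integral lborel (\<phi> i) 1"
    and moment: "\<forall>\<^sub>F i in F. integrable lborel (\<lambda>x. norm x ^ p * \<phi> i x)
                   \<and> (LINT x|lborel. norm x ^ p * \<phi> i x) \<le> m i"
    and m: "(m \<longlongrightarrow> 0) F"
  shows "weakly_tendsto u (\<lambda>f. - dirac_delta f) F"
  unfolding weakly_tendsto_def dirac_delta_def
proof (intro allI impI)
  fix f :: "'a \<Rightarrow> real" assume f: "test_function f"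
  then have cont: "continuous_on UNIV f"
    by (auto simp: test_function_def dest: spec [of _ 0])
  obtain B where "\<And>x. \<bar>f x\<bar> \<le> B"
    using test_function_bounded [OF f] by blast
  from weak_limit_if_moment_vanishes [OF nonneg mass moment m cont this]
  have int: "\<forall>\<^sub>F i in F. integrable lborel (\<lambda>x. \<phi> i x * f x)"
    and lim: "((\<lambda>i. LINT x|lborel. \<phi> i x * f x) \<longlongrightarrow> f 0) F"
    by auto
  have "\<forall>\<^sub>F i in F. integrable lborel (\<lambda>x. u i x * f x)"
    using u int by eventually_elim simp
  moreover have "((\<lambda>i. LINT x|lborel. u i x * f x) \<longlongrightarrow> - f 0) F"
  proof (rule Lim_transform_eventually)
    show "((\<lambda>i. - (LINT x|lborel. \<phi> i x * f x)) \<longlongrightarrow> - f 0) F"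
      by (intro tendsto_minus lim)
    show "\<forall>\<^sub>F i in F. - (LINT x|lborel. \<phi> i x * f x) = (LINT x|lborel. u i x * f x)"
      using u by eventually_elim simp
  qed
  ultimately show "(\<forall>\<^sub>F i in F. integrable lborel (\<lambda>x. u i x * f x)) \<and>
      ((\<lambda>i. LINT x|lborel. u i x * f x) \<longlongrightarrow> - f 0) F"
    by blast
qed

section \<open>The blob\<close>

text \<open>The negative of the Laplacian of the regularised kernel.\<close>

definition blob :: "real \<Rightarrow> nat \<Rightarrow> 'a::euclidean_space \<Rightarrow> real" where
  "blob e n x = blob_const (real DIM('a)) n * e ^ (2 * n + 2)
                  * ((norm x)\<^sup>2 + e\<^sup>2) powr - (real n + 1 + real DIM('a) / 2)"

lemma blob_const_pos: "d \<ge> 0 \<Longrightarrow> blob_const d n > 0"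
  by (simp add: blob_const_def add_pos_nonneg)

lemma blob_nonneg: "blob e n x \<ge> 0"
proof -
  have "e ^ (2 * n + 2) = (e ^ (n + 1))\<^sup>2"
    using power_even_eq [of e "n + 1"] by simp
  then show ?thesis
    unfolding blob_def using blob_const_pos [of "real DIM('a)" n]
    by (simp add: less_imp_le)
qed

lemma power_mult_square_powr:
  fixes e z :: real
  assumes "e > 0"
  shows "e ^ (2 * n + 2) * (e\<^sup>2) powr z = e powr (2 * (real n + 1 + z))"
proof -
  have "(e\<^sup>2) powr z = e powr (2 * z)"
    using assms powr_powr [of e 2 z] by simp
  moreover have "e ^ (2 * n + 2) = e powr (2 * (real n + 1))"
    using assms powr_realpow [of e "2 * n + 2"] by (simp add: distrib_left add_ac)
  ultimately show ?thesis
    by (simp add: powr_add [symmetric] distrib_left)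
qed

lemma has_bochner_integral_blob:
  assumes e: "e > 0"
  shows "has_bochner_integral lborel (blob e n :: 'a::euclidean_space \<Rightarrow> real) 1"
proof -
  define k where "k = real DIM('a) / 2"
  have "real n + 1 + k > 0"
    by (simp add: k_def add_pos_nonneg)
  then have G: "Gamma (real n + 1 + k) > 0"
    by simp
  have e': "e ^ (2 * n + 2) * (e\<^sup>2) powr - (real n + 1) = 1"
    using e by (subst power_mult_square_powr) auto
  have "blob_const (real DIM('a)) n * e ^ (2 * n + 2) *
      (pi powr k * Gamma (real n + 1) / Gamma (real n + 1 + k) * (e\<^sup>2) powr - (real n + 1))
      = (blob_const (real DIM('a)) n * (pi powr k * Gamma (real n + 1) / Gamma (real n + 1 + k)))
         * (e ^ (2 * n + 2) * (e\<^sup>2) powr - (real n + 1))"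
    by (simp only: mult_ac)
  also have "\<dots> = 1"
    unfolding e' using less_imp_neq [OF G, symmetric] Gamma_fact [of n, where 'a = real]
    by (simp add: blob_const_def k_def add_ac)
  finally have mass: "blob_const (real DIM('a)) n * e ^ (2 * n + 2) *
      (pi powr k * Gamma (real n + 1) / Gamma (real n + 1 + k) * (e\<^sup>2) powr - (real n + 1)) = 1" .
  have "has_bochner_integral lborel (\<lambda>x::'a. ((norm x)\<^sup>2 + e\<^sup>2) powr - (real n + 1 + k))
      (pi powr k * Gamma (real n + 1) / Gamma (real n + 1 + k) * (e\<^sup>2) powr - (real n + 1))"
    using has_bochner_integral_shifted_power
      [where 'a = 'a and \<alpha> = "real n + 1 + k" and c = "e\<^sup>2"] e
    by (simp add: k_def)
  from has_bochner_integral_mult_right [OF this, of "blob_const (real DIM('a)) n * e ^ (2 * n + 2)"]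
  show ?thesis
    unfolding mass blob_def [abs_def] k_def [symmetric] .
qed

text \<open>As \<open>\<parallel>x\<parallel>\<^sup>2 = s - e\<^sup>2\<close>, where \<open>s = \<parallel>x\<parallel>\<^sup>2 + e\<^sup>2\<close>, and multiplying the blob of index \<open>n + 1\<close> by \<open>s\<close> gives a multiple of the
  blob of index \<open>n\<close>, the second moment is a difference of two unit masses with known factors.\<close>

lemma blob_second_moment:
  assumes e: "e > 0"
  shows "has_bochner_integral lborel (\<lambda>x::'a::euclidean_space. norm x ^ 2 * blob e (Suc n) x)
           (e\<^sup>2 * real DIM('a) / (2 * real (Suc n)))"
proof -
  define k where "k = real DIM('a) / 2"
  define q where "q = (real n + 1 + k) / (real n + 1)"
  have M: "blob_const (real DIM('a)) (Suc n) = q * blob_const (real DIM('a)) n"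
    by (simp add: blob_const_Suc q_def k_def)
  have shift: "((norm x)\<^sup>2 + e\<^sup>2) * blob e (Suc n) x = q * e\<^sup>2 * blob e n x" for x :: 'a
  proof -
    have "(norm x)\<^sup>2 + e\<^sup>2 > 0"
      using e by (simp add: add_nonneg_pos)
    then have "((norm x)\<^sup>2 + e\<^sup>2) * ((norm x)\<^sup>2 + e\<^sup>2) powr - (real (Suc n) + 1 + k)
        = ((norm x)\<^sup>2 + e\<^sup>2) powr - (real n + 1 + k)"
      using powr_add [of "(norm x)\<^sup>2 + e\<^sup>2" 1 "- (real (Suc n) + 1 + k)"] by (simp add: algebra_simps)
    then show ?thesis
      by (simp add: blob_def M k_def [symmetric] power2_eq_square)
  qed
  have "norm x ^ 2 * blob e (Suc n) x = q * e\<^sup>2 * blob e n x - e\<^sup>2 * blob e (Suc n) x" for x :: 'a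
    unfolding shift [symmetric] by (simp add: distrib_right)
  moreover have "has_bochner_integral lborel
      (\<lambda>x::'a. q * e\<^sup>2 * blob e n x - e\<^sup>2 * blob e (Suc n) x) (q * e\<^sup>2 * 1 - e\<^sup>2 * 1)"
    by (intro has_bochner_integral_diff has_bochner_integral_mult_right has_bochner_integral_blob e)
  moreover have "q * e\<^sup>2 * 1 - e\<^sup>2 * 1 = e\<^sup>2 * real DIM('a) / (2 * real (Suc n))"
    by (simp add: q_def k_def field_simps)
  ultimately show ?thesis
    by simp
qed

text \<open>Replacing \<open>\<parallel>x\<parallel>\<close> by the larger \<open>sqrt s\<close> turns the integrand into a shifted power, which is still
  integrable for \<open>n = 0\<close>, and whose integral scales like \<open>e\<close>.\<close>

lemma blob_first_moment_le:
  obtains C where "\<And>e. e > 0 \<Longrightarrow> integrable lborel (\<lambda>x::'a::euclidean_space. norm x ^ 1 * blob e n x)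
      \<and> (LINT x|lborel. norm (x::'a) ^ 1 * blob e n x) \<le> C * e"
proof
  define k where "k = real DIM('a) / 2"
  define J where "J = pi powr k * Gamma (real n + 1 / 2) / Gamma (real n + 1 / 2 + k)"
  define M where "M = blob_const (real DIM('a)) n"
  have M: "M > 0"
    by (simp add: M_def blob_const_pos)
  fix e :: real assume e: "e > 0"
  let ?g = "\<lambda>x::'a. M * e ^ (2 * n + 2) * ((norm x)\<^sup>2 + e\<^sup>2) powr - (real n + 1 / 2 + k)"
  have g: "has_bochner_integral lborel ?g
      (M * e ^ (2 * n + 2) * (J * (e\<^sup>2) powr (- real n - 1 / 2)))"
    using has_bochner_integral_mult_right [OF has_bochner_integral_shifted_power
        [where 'a = 'a and \<alpha> = "real n + 1 / 2 + k" and c = "e\<^sup>2"],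
        of "M * e ^ (2 * n + 2)"] e
    by (simp add: J_def k_def)
  have "e ^ (2 * n + 2) * (e\<^sup>2) powr (- real n - 1 / 2) = e"
    using e by (subst power_mult_square_powr) auto
  then have val: "M * e ^ (2 * n + 2) * (J * (e\<^sup>2) powr (- real n - 1 / 2)) = M * J * e"
    by (metis mult.assoc mult.left_commute)
  have le: "norm x ^ 1 * blob e n x \<le> ?g x" for x :: 'a
  proof -
    have pos: "(norm x)\<^sup>2 + e\<^sup>2 > 0"
      using e by (simp add: add_nonneg_pos)
    have "norm x \<le> ((norm x)\<^sup>2 + e\<^sup>2) powr (1 / 2)"
      using pos by (simp add: powr_half_sqrt real_le_rsqrt)
    then have "norm x * ((norm x)\<^sup>2 + e\<^sup>2) powr - (real n + 1 + k)
        \<le> ((norm x)\<^sup>2 + e\<^sup>2) powr (1 / 2) * ((norm x)\<^sup>2 + e\<^sup>2) powr - (real n + 1 + k)"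
      by (intro mult_right_mono) auto
    also have "\<dots> = ((norm x)\<^sup>2 + e\<^sup>2) powr - (real n + 1 / 2 + k)"
    proof -
      have "1 / 2 + - (real n + 1 + k) = - (real n + 1 / 2 + k)"
        by simp
      then show ?thesis
        by (metis powr_add)
    qed
    finally have "M * e ^ (2 * n + 2) * (norm x * ((norm x)\<^sup>2 + e\<^sup>2) powr - (real n + 1 + k))
        \<le> ?g x"
      using M e by (intro mult_left_mono) auto
    then show ?thesis
      by (simp add: blob_def M_def k_def mult_ac)
  qed
  have int: "integrable lborel (\<lambda>x::'a. norm x ^ 1 * blob e n x)"
  proof (rule Bochner_Integration.integrable_bound)
    show "integrable lborel ?g"
      using g by (auto simp: has_bochner_integral_iff)
    show "(\<lambda>x::'a. norm x ^ 1 * blob e n x) \<in> borel_measurable lborel"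
      unfolding blob_def by measurable
    show "AE x in lborel. norm (norm (x::'a) ^ 1 * blob e n x) \<le> norm (?g x)"
    proof (rule AE_I2)
      fix x :: 'a
      show "norm (norm x ^ 1 * blob e n x) \<le> norm (?g x)"
        using le [of x] blob_nonneg [of e n x] M e by (simp add: abs_mult)
    qed
  qed
  moreover have "(LINT x|lborel. norm (x::'a) ^ 1 * blob e n x) \<le> integral\<^sup>L lborel ?g"
    using g by (intro integral_mono int le) (auto simp: has_bochner_integral_iff)
  ultimately show "integrable lborel (\<lambda>x::'a. norm x ^ 1 * blob e n x)
      \<and> (LINT x|lborel. norm (x::'a) ^ 1 * blob e n x) \<le> M * J * e"
    using g unfolding val has_bochner_integral_iff by (metis (no_types, lifting))
qed

section \<open>Weak limits of the Laplacian\<close>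

lemma laplacian_reg_kernel:
  fixes x :: "real ^ 'd"
  assumes card: "CARD('d::finite) \<in> {1, 2, 3}" and e: "e > 0"
  shows "laplacian (\<lambda>x :: real ^ 'd. reg_kernel CARD('d) e n (norm x)) x = - blob e n x"
proof -
  have "(1 / 2 :: real) \<notin> \<int>\<^sub>\<le>\<^sub>0" "(3 / 2 :: real) \<notin> \<int>\<^sub>\<le>\<^sub>0"
    using nonpos_Ints_nonpos [of "1 / 2 :: real"] nonpos_Ints_nonpos [of "3 / 2 :: real"] by auto
  then have half: "Gamma (3 / 2 :: real) = sqrt pi / 2" "Gamma (5 / 2 :: real) = 3 / 4 * sqrt pi"
    using Gamma_plus1 [of "1 / 2 :: real"] Gamma_plus1 [of "3 / 2 :: real"]
    by (simp_all add: Gamma_one_half_real)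
  have radial: ?thesis
    if "has_radial_laplacian (real CARD('d)) (e\<^sup>2) h
          (\<lambda>s. - blob_const (real CARD('d)) n * e ^ (2 * n + 2)
                 * s powr - (real n + 1 + real CARD('d) / 2))"
      and "\<And>r. reg_kernel CARD('d) e n r = h (r\<^sup>2 + e\<^sup>2)" for h
    using laplacian_radial [where 'a = "real ^ 'd" and h = h and c = "e\<^sup>2" and x = x] that e
    by (simp add: blob_def)
  consider (one) "CARD('d) = 1" | (two) "CARD('d) = 2" | (three) "CARD('d) = 3"
    using card by auto
  then show ?thesis
  proof cases
    case one
    \<comment> \<open>\<open>a = 1/2\<close> and \<open>\<kappa> = - 1/2\<close>\<close>
    have "4 * (1 - 1 / 2) * (- (1 / 2)) * (- (1 / 2)) = blob_const 1 0"
      by (simp add: blob_const_def half powr_half_sqrt)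
    from binomial_kernel_laplacian [OF _ _ this] show ?thesis
      by (intro radial) (simp_all add: one reg_kernel_def)
  next
    case two
    from logarithmic_kernel_laplacian show ?thesis
      by (intro radial) (simp_all add: two reg_kernel_def)
  next
    case three
    \<comment> \<open>\<open>a = - 1/2\<close> and \<open>\<kappa> = 1 / (4 * pi)\<close>\<close>
    have "pi powr (3 / 2) = pi * sqrt pi"
      using powr_add [of pi 1 "1 / 2"] by (simp add: powr_half_sqrt)
    then have "4 * (1 - - (1 / 2)) * (- (- (1 / 2))) * (1 / (4 * pi)) = blob_const 3 0"
      by (simp add: blob_const_def half)
    from binomial_kernel_laplacian [OF _ _ this] show ?thesis
      by (intro radial) (simp_all add: three reg_kernel_def)
  qed
qed

theorem theorem2:
  assumes "CARD('d::finite) \<in> {1, 2, 3}"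
  shows "(\<forall>\<epsilon>>0. weakly_tendsto
            (\<lambda>n. laplacian (\<lambda>x :: real ^ 'd. reg_kernel CARD('d) \<epsilon> n (norm x)))
            (\<lambda>f. - dirac_delta f) sequentially)
       \<and> (\<forall>n. weakly_tendsto
            (\<lambda>\<epsilon>. laplacian (\<lambda>x :: real ^ 'd. reg_kernel CARD('d) \<epsilon> n (norm x)))
            (\<lambda>f. - dirac_delta f) (at_right 0))"
proof (intro conjI allI impI)
  fix \<epsilon> :: real assume e: "\<epsilon> > 0"
  let ?m = "\<lambda>n. \<epsilon>\<^sup>2 * real CARD('d) / 2 * (1 / real n)"
  show "weakly_tendsto (\<lambda>n. laplacian (\<lambda>x :: real ^ 'd. reg_kernel CARD('d) \<epsilon> n (norm x)))
      (\<lambda>f. - dirac_delta f) sequentially"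
  proof (rule weakly_tendsto_minus_dirac_delta [where \<phi> = "blob \<epsilon>" and p = 2 and m = ?m])
    show "\<forall>\<^sub>F n in sequentially. \<forall>x. laplacian (\<lambda>x :: real ^ 'd. reg_kernel CARD('d) \<epsilon> n (norm x)) x
        = - blob \<epsilon> n x"
      using assms e by (simp add: laplacian_reg_kernel)
    show "\<forall>\<^sub>F n in sequentially. has_bochner_integral lborel (blob \<epsilon> n :: real ^ 'd \<Rightarrow> real) 1"
      using e by (simp add: has_bochner_integral_blob)
    show "\<forall>\<^sub>F n in sequentially. integrable lborel (\<lambda>x :: real ^ 'd. norm x ^ 2 * blob \<epsilon> n x)
        \<and> (LINT x|lborel. norm (x :: real ^ 'd) ^ 2 * blob \<epsilon> n x) \<le> ?m n"
      using eventually_gt_at_top [of 0]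
    proof eventually_elim
      case (elim n)
      then obtain k where "n = Suc k"
        using gr0_conv_Suc by blast
      then show ?case
        using blob_second_moment [OF e, of k, where 'a = "real ^ 'd"]
        by (simp add: has_bochner_integral_iff)
    qed
    show "?m \<longlonglongrightarrow> 0"
      by (intro tendsto_mult_right_zero lim_1_over_n)
  qed (rule blob_nonneg)
next
  fix n :: nat
  obtain C where C: "\<And>e. e > 0 \<Longrightarrow> integrable lborel (\<lambda>x :: real ^ 'd. norm x ^ 1 * blob e n x)
      \<and> (LINT x|lborel. norm (x :: real ^ 'd) ^ 1 * blob e n x) \<le> C * e"
    using blob_first_moment_le [of n, where 'a = "real ^ 'd"] by blast
  have pos: "\<forall>\<^sub>F e in at_right 0. (e :: real) > 0"
    by (simp add: eventually_at_right_less)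
  show "weakly_tendsto (\<lambda>\<epsilon>. laplacian (\<lambda>x :: real ^ 'd. reg_kernel CARD('d) \<epsilon> n (norm x)))
      (\<lambda>f. - dirac_delta f) (at_right 0)"
  proof (rule weakly_tendsto_minus_dirac_delta
      [where \<phi> = "\<lambda>e. blob e n" and p = 1 and m = "\<lambda>e. C * e"])
    show "\<forall>\<^sub>F e in at_right 0. \<forall>x. laplacian (\<lambda>x :: real ^ 'd. reg_kernel CARD('d) e n (norm x)) x
        = - blob e n x"
      using pos by eventually_elim (use assms in \<open>simp add: laplacian_reg_kernel\<close>)
    show "\<forall>\<^sub>F e in at_right 0. has_bochner_integral lborel (blob e n :: real ^ 'd \<Rightarrow> real) 1"
      using pos by eventually_elim (rule has_bochner_integral_blob)
    show "\<forall>\<^sub>F e in at_right 0. integrable lborel (\<lambda>x :: real ^ 'd. norm x ^ 1 * blob e n x)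
        \<and> (LINT x|lborel. norm (x :: real ^ 'd) ^ 1 * blob e n x) \<le> C * e"
      using pos by eventually_elim (rule C)
    show "((\<lambda>e. C * e) \<longlongrightarrow> 0) (at_right 0)"
      by (intro tendsto_mult_right_zero tendsto_ident_at)
  qed (rule blob_nonneg)
qed

end
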